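(* Let $V$ be a maximal isotropic subspace of $\mathbb C^n$ and let $M(V)$ be the set of matrices in $\mathbb C^{n\times n}$ with rows all contained in $V$. Then the complex vector space $$\mathcal E_V=\{\phi_A:\mathrm{GL}_n(\mathbb R)\to\mathbb C\ |\ \phi_A(x)=\mathrm{trace}(Ax^t),\ A\in M(V)\}$$ is an eigenfamily on $\mathrm{GL}_n(\mathbb R)$.
   Context: A subspace $V\subset\mathbb C^n$ is isotropic if $(u,v)=\sum_i u_iv_i=0$ for all $u,v\in V$ (standard complex bilinear form). The group $\mathrm{GL}_n(\mathbb R)$ carries its standard left-invariant Riemannian metric, induced by the scalar product $g(Z,W)=\mathrm{Re}\,\mathrm{trace}(ZW^* )$ on its Lie algebra $\mathfrak{gl}_n(\mathbb R)=\mathbb R^{n\times n}$. For complex valued functions $\phi,\psi$ on a Lie group with left-invariant Riemannian metric, the Laplacian (tension field) $\tau$ and the operator $\kappa(\phi,\psi)=g(\mathrm{grad}(\phi),\mathrm{grad}(\psi))$ ($g$ extended complex bilinearly) are given by $\tau(\phi)=\sum_{Z\in\mathcal B}Z^2(\phi)$ and $\kappa(\phi,\psi)=\sum_{Z\in\mathcal B}Z(\phi)Z(\psi)$, where $\mathcal B$ is any orthonormal basis of the Lie algebra of left-invariant vector fields, $Z(\phi)(p)=\frac{d}{ds}[\phi(p\cdot\exp(sZ))]|_{s=0}$ and $Z^2(\phi)(p)=\frac{d^2}{ds^2}[\phi(p\cdot\exp(sZ))]|_{s=0}$. A set $\mathcal E$ of complex valued functions is an eigenfamily if there exist $\lambda,\mu\in\mathbb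 C$ with $\tau(\phi)=\lambda\phi$ and $\kappa(\phi,\psi)=\mu\phi\psi$ for all $\phi,\psi\in\mathcal E$. *)

theory Defs
  imports "HOL-Analysis.Analysis" "HOL-Library.Function_Algebras"
begin

section \<open>Isotropic subspaces of $\mathbb{C}^n$\<close>

text \<open>The form is complex bilinear (no conjugation), unlike the inner product of the library.\<close>

definition cbilin :: "complex^'n \<Rightarrow> complex^'n \<Rightarrow> complex" where
  "cbilin u v = (\<Sum>i\<in>UNIV. u $ i * v $ i)"

definition isotropic :: "(complex^'n) set \<Rightarrow> bool" where
  "isotropic V \<longleftrightarrow> vec.subspace V \<and> (\<forall>u\<in>V. \<forall>v\<in>V. cbilin u v = 0)"

definition maximal_isotropic :: "(complex^'n) set \<Rightarrow> bool" where
  "maximal_isotropic V \<longleftrightarrow> isotropic V \<and> (\<forall>W. isotropic W \<and> V \<subseteq> W \<longrightarrow> W = V)"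

section \<open>The Lie group of invertible real matrices\<close>

definition GL :: "(real^'n^'n) set" where
  "GL = {x. invertible x}"

definition mat_exp :: "real^'n^'n \<Rightarrow> real^'n^'n" where
  "mat_exp Z = (\<Sum>k. (1 / fact k) *\<^sub>R (((**) Z) ^^ k) (mat 1))"

text \<open>For real matrices $ZW^*$ is $ZW^t$ and its trace is real.\<close>

definition gl_metric :: "real^'n^'n \<Rightarrow> real^'n^'n \<Rightarrow> real" where
  "gl_metric Z W = trace (Z ** transpose W)"

definition gl_orthonormal_basis :: "(real^'n^'n) set \<Rightarrow> bool" where
  "gl_orthonormal_basis B \<longleftrightarrow> finite B \<and> independent B \<and> span B = UNIV \<and>
     (\<forall>Z\<in>B. \<forall>W\<in>B. gl_metric Z W = (if Z = W then 1 else 0))"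

lemma gl_metric_eq_inner: "gl_metric Z W = Z \<bullet> W"
  by (simp add: gl_metric_def trace_def matrix_matrix_mult_def transpose_def inner_vec_def)

lemma gl_orthonormal_basis_Basis: "gl_orthonormal_basis (Basis :: (real^'n^'n) set)"
  by (simp add: gl_orthonormal_basis_def gl_metric_eq_inner inner_Basis independent_Basis)

text \<open>A function on the group is represented by a function on all real matrices; only its values
  on \<^const>\<open>GL\<close> matter for the operators below, because \<open>p ** mat_exp (s *\<^sub>R Z)\<close> is
  invertible whenever \<open>p\<close> is.\<close>

definition lie_deriv :: "real^'n^'n \<Rightarrow> (real^'n^'n \<Rightarrow> complex) \<Rightarrow> real^'n^'n \<Rightarrow> complex" where
  "lie_deriv Z \<phi> p = vector_derivative (\<lambda>s. \<phi> (p ** mat_exp (s *\<^sub>R Z))) (at 0)"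

definition lie_deriv2 :: "real^'n^'n \<Rightarrow> (real^'n^'n \<Rightarrow> complex) \<Rightarrow> real^'n^'n \<Rightarrow> complex" where
  "lie_deriv2 Z \<phi> p =
     vector_derivative
       (\<lambda>s. vector_derivative (\<lambda>t. \<phi> (p ** mat_exp (t *\<^sub>R Z))) (at s)) (at 0)"

definition tension ::
    "(real^'n^'n) set \<Rightarrow> (real^'n^'n \<Rightarrow> complex) \<Rightarrow> real^'n^'n \<Rightarrow> complex" where
  "tension B \<phi> p = (\<Sum>Z\<in>B. lie_deriv2 Z \<phi> p)"

definition kappa ::
    "(real^'n^'n) set \<Rightarrow> (real^'n^'n \<Rightarrow> complex) \<Rightarrow> (real^'n^'n \<Rightarrow> complex)
      \<Rightarrow> real^'n^'n \<Rightarrow> complex" where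
  "kappa B \<phi> \<psi> p = (\<Sum>Z\<in>B. lie_deriv Z \<phi> p * lie_deriv Z \<psi> p)"

text \<open>On an open subset of a finite-dimensional space, \<open>Ck_on k S f\<close> says that \<open>f\<close> is of class
  $C^k$ on \<open>S\<close>, stated by recursion on the directional derivatives.\<close>

primrec Ck_on :: "nat \<Rightarrow> 'a::real_normed_vector set \<Rightarrow> ('a \<Rightarrow> 'b::real_normed_vector) \<Rightarrow> bool" where
  "Ck_on 0 S f \<longleftrightarrow> continuous_on S f"
| "Ck_on (Suc k) S f \<longleftrightarrow>
     (\<exists>f'. (\<forall>x\<in>S. (f has_derivative f' x) (at x)) \<and> (\<forall>v. Ck_on k S (\<lambda>x. f' x v)))"

text \<open>Smoothness is the standing assumption under which the operators are defined; it excludes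
  the junk values of \<^const>\<open>vector_derivative\<close>. The equations are required for every
  orthonormal basis, with \<open>l\<close> and \<open>m\<close> not depending on the basis;
  such bases exist, see \<open>gl_orthonormal_basis_Basis\<close>.\<close>

definition eigenfamily :: "(real^'n^'n \<Rightarrow> complex) set \<Rightarrow> bool" where
  "eigenfamily E \<longleftrightarrow>
     (\<forall>\<phi>\<in>E. \<forall>k. Ck_on k GL \<phi>) \<and>
     (\<exists>l m. \<forall>B. gl_orthonormal_basis B \<longrightarrow>
        (\<forall>\<phi>\<in>E. \<forall>p\<in>GL. tension B \<phi> p = l * \<phi> p) \<and>
        (\<forall>\<phi>\<in>E. \<forall>\<psi>\<in>E. \<forall>p\<in>GL. kappa B \<phi> \<psi> p = m * \<phi> p * \<psi> p))"

section \<open>The family attached to a subspace\<close>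

definition row_matrices :: "(complex^'n) set \<Rightarrow> (complex^'n^'n) set" where
  "row_matrices V = {A. \<forall>i. row i A \<in> V}"

text \<open>Functions with domain \<^const>\<open>GL\<close> are extended by \<open>0\<close>, so that equality, sum and scalar
  multiples of these total functions are those of functions on the group.\<close>

definition phi :: "complex^'n^'n \<Rightarrow> real^'n^'n \<Rightarrow> complex" where
  "phi A x = (if x \<in> GL then trace (A ** transpose (map_matrix complex_of_real x)) else 0)"

definition family :: "(complex^'n) set \<Rightarrow> (real^'n^'n \<Rightarrow> complex) set" where
  "family V = phi ` row_matrices V"

text \<open>Complex vector space structure of functions, with pointwise operations.\<close>

definition complex_function_space :: "('a \<Rightarrow> complex) set \<Rightarrow> bool" where
  "complex_function_space E \<longleftrightarrow> module.subspace (\<lambda>c \<phi> x. c * \<phi> x) E"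

end

theory Submission
  imports Defs
begin

text \<open>
  On \<^const>\<open>GL\<close> every \<open>phi A\<close> is the restriction of a real-linear function \<open>L\<^sub>A\<close> of the
  matrix, so along \<open>p ** mat_exp (s *\<^sub>R Z)\<close> its first and second derivatives at \<open>s = 0\<close> are
  \<open>L\<^sub>A (p ** Z)\<close> and \<open>L\<^sub>A (p ** (Z ** Z))\<close> (lemma \<open>lie_derivs_linear\<close>). What remains is to sum
  over an orthonormal basis. All such sums come from one contraction rule
  (lemma \<open>orthonormal_basis_entries\<close>): the sum of \<open>Z\<^sub>i\<^sub>j Z\<^sub>k\<^sub>l\<close> over the basis is \<open>1\<close> if
  \<open>(i,j) = (k,l)\<close> and \<open>0\<close> otherwise.

  For the tension field the rule says that the squares \<open>Z ** Z\<close> add up to the identity matrix, so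
  \<open>\<tau>(phi A) = phi A\<close> for every \<open>A\<close> and the eigenvalue is \<open>\<lambda> = 1\<close>. For \<open>\<kappa>\<close>, the function
  \<open>Z \<mapsto> L\<^sub>A (p ** Z)\<close> pairs \<open>Z\<close> entrywise with the matrix \<open>p\<^sup>t A\<close>, so the rule gives
  \<open>\<kappa>(phi A, phi C) (p) = \<Sum>\<^sub>i\<^sub>j (p\<^sup>t A)\<^sub>i\<^sub>j (p\<^sup>t C)\<^sub>i\<^sub>j\<close>. This is the sum over \<open>i\<close> of the bilinear form
  of the \<open>i\<close>-th rows of \<open>p\<^sup>t A\<close> and \<open>p\<^sup>t C\<close>. These rows are linear combinations of rows of \<open>A\<close>
  and \<open>C\<close>, hence lie in \<open>V\<close>; as \<open>V\<close> is isotropic the sum vanishes, and \<open>\<mu> = 0\<close>.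
\<close>

section \<open>The matrix exponential curve\<close>

lemma bounded_bilinear_matrix_mult:
  "bounded_bilinear ((**) :: real^'m^'n \<Rightarrow> real^'k^'m \<Rightarrow> real^'k^'n)"
  unfolding bilinear_conv_bounded_bilinear [symmetric] bilinear_def linear_iff
  by (simp add: matrix_matrix_mult_def vec_eq_iff sum.distrib sum_distrib_left algebra_simps)

lemma matrix_power_scaleR:
  fixes Z :: "real^'n^'n"
  shows "((**) (s *\<^sub>R Z) ^^ k) (mat 1) = s ^ k *\<^sub>R ((**) Z ^^ k) (mat 1)"
proof (induction k)
  case (Suc k)
  then show ?case
    by (simp add: bounded_bilinear.scaleR_left [OF bounded_bilinear_matrix_mult]
        bounded_bilinear.scaleR_right [OF bounded_bilinear_matrix_mult])
qed simp

text \<open>If \<open>K\<close> bounds the matrix product as a bilinear map, \<open>norm (Z\<^sup>k)\<close> is at most a multiple of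
  \<open>(K * norm Z) ^ k\<close>, so a real exponential series dominates.\<close>

lemma summable_mat_exp:
  fixes Z :: "real^'n^'n"
  shows "summable (\<lambda>k. (s ^ k / fact k) *\<^sub>R ((**) Z ^^ k) (mat 1))"
proof -
  obtain K where K: "K > 0" "\<And>(X::real^'n^'n) (Y::real^'n^'n). norm (X ** Y) \<le> norm X * norm Y * K"
    using bounded_bilinear.pos_bounded [OF bounded_bilinear_matrix_mult] by blast
  have pow: "norm (((**) Z ^^ k) (mat 1)) \<le> (K * norm Z) ^ k * norm (mat 1 :: real^'n^'n)" for k
  proof (induction k)
    case (Suc k)
    have "norm (((**) Z ^^ Suc k) (mat 1)) \<le> (K * norm Z) * norm (((**) Z ^^ k) (mat 1))"
      using K(2) [of Z "((**) Z ^^ k) (mat 1)"] by (simp add: mult_ac)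
    also have "\<dots> \<le> (K * norm Z) * ((K * norm Z) ^ k * norm (mat 1 :: real^'n^'n))"
      using Suc K(1) by (intro mult_left_mono) auto
    finally show ?case by (simp add: mult_ac)
  qed simp
  show ?thesis
  proof (rule summable_comparison_test')
    show "summable (\<lambda>k. inverse (fact k) * (\<bar>s\<bar> * (K * norm Z)) ^ k * norm (mat 1 :: real^'n^'n))"
      by (intro summable_mult2 summable_exp)
    show "norm ((s ^ k / fact k) *\<^sub>R ((**) Z ^^ k) (mat 1))
        \<le> inverse (fact k) * (\<bar>s\<bar> * (K * norm Z)) ^ k * norm (mat 1 :: real^'n^'n)"
      if "k \<ge> 0" for k
      using mult_left_mono [OF pow [of k], of "\<bar>s\<bar> ^ k / fact k"]
      by (simp add: power_abs power_mult_distrib abs_mult field_simps)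
  qed
qed

lemma mat_exp_scaleR:
  "mat_exp (s *\<^sub>R Z) = (\<Sum>k. (s ^ k / fact k) *\<^sub>R ((**) Z ^^ k) (mat 1))"
  by (simp add: mat_exp_def matrix_power_scaleR)

lemma mat_exp_0: "mat_exp 0 = (mat 1 :: real^'n^'n)"
proof -
  have "mat_exp (0 :: real^'n^'n) = (\<Sum>k. if k = 0 then mat 1 else 0 :: real^'n^'n)"
    using mat_exp_scaleR [of 0 "0 :: real^'n^'n"]
    by (simp add: power_0_left if_distrib [of "\<lambda>c. c *\<^sub>R _"] if_distrib [of "\<lambda>c. c / _"]
        cong: if_cong)
  then show ?thesis
    using sums_unique [OF sums_single [of 0 "\<lambda>_. mat 1 :: real^'n^'n"]] by simp
qed

text \<open>Each coordinate of the curve is a real power series in \<open>s\<close> that converges everywhere, so it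
  may be differentiated term by term; the factor \<open>Z\<close> comes from the index shift.\<close>

lemma mat_exp_has_vector_derivative:
  fixes Z :: "real^'n^'n"
  shows "((\<lambda>s. mat_exp (s *\<^sub>R Z)) has_vector_derivative Z ** mat_exp (s *\<^sub>R Z)) (at s)"
  unfolding has_vector_derivative_def
proof (subst has_derivative_componentwise_within, intro ballI)
  fix b :: "real^'n^'n"
  define c where "c k = ((**) Z ^^ k) (mat 1) \<bullet> b / fact k" for k
  have lin: "bounded_linear (\<lambda>X. (Z ** X) \<bullet> b)"
    using bounded_linear_compose [OF bounded_linear_inner_left
        bounded_bilinear.bounded_linear_right [OF bounded_bilinear_matrix_mult]] .
  have c_series: "(\<lambda>k. c k * y ^ k) sums (mat_exp (y *\<^sub>R Z) \<bullet> b)" for y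
    using bounded_linear.sums [OF bounded_linear_inner_left summable_sums [OF summable_mat_exp],
        of y Z b]
    by (simp add: mat_exp_scaleR c_def mult_ac)
  have diffs: "(\<lambda>k. diffs c k * s ^ k) sums ((Z ** mat_exp (s *\<^sub>R Z)) \<bullet> b)"
  proof -
    have "diffs c k = (Z ** ((**) Z ^^ k) (mat 1)) \<bullet> b / fact k" for k
      by (simp add: diffs_def c_def field_simps del: of_nat_Suc)
    then show ?thesis
      using bounded_linear.sums [OF lin summable_sums [OF summable_mat_exp], of s Z]
      by (simp add: mat_exp_scaleR mult_ac
          bounded_bilinear.scaleR_right [OF bounded_bilinear_matrix_mult])
  qed
  have "((\<lambda>y. \<Sum>k. c k * y ^ k) has_field_derivative (\<Sum>k. diffs c k * s ^ k)) (at s)"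
    using c_series by (intro termdiffs_strong_converges_everywhere) (auto simp: sums_iff)
  then have "((\<lambda>y. mat_exp (y *\<^sub>R Z) \<bullet> b) has_field_derivative (Z ** mat_exp (s *\<^sub>R Z)) \<bullet> b) (at s)"
    using c_series diffs by (simp add: sums_iff)
  then show "((\<lambda>y. mat_exp (y *\<^sub>R Z) \<bullet> b) has_derivative
      (\<lambda>h. (h *\<^sub>R (Z ** mat_exp (s *\<^sub>R Z))) \<bullet> b)) (at s)"
    by (simp add: has_field_derivative_def mult_commute_abs)
qed

section \<open>Derivatives of linear functions on the group\<close>

lemma open_GL: "open (GL :: (real^'n^'n) set)"
proof -
  have "continuous_on UNIV (det :: real^'n^'n \<Rightarrow> real)"
    unfolding det_def by (intro continuous_intros)
  then have "open (det -` (- {0}) :: (real^'n^'n) set)"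
    by (intro open_vimage) auto
  also have "det -` (- {0}) = (GL :: (real^'n^'n) set)"
    by (auto simp: GL_def invertible_det_nz)
  finally show ?thesis .
qed

lemma Ck_on_const: "Ck_on k S (\<lambda>_. c)"
proof (induction k arbitrary: c)
  case (Suc k)
  show ?case
    unfolding Ck_on.simps
    using Suc [of 0] by (intro exI [of _ "\<lambda>_ _. 0"]) auto
qed simp

text \<open>The derivative of a linear function is the same at all points, so its directional derivatives
  are constants and all higher ones vanish. Openness of \<open>S\<close> makes the values of \<open>f\<close> outside \<open>S\<close>
  irrelevant for the derivatives at points of \<open>S\<close>.\<close>

lemma Ck_on_eq_bounded_linear:
  assumes "open S" "bounded_linear L" "\<And>x. x \<in> S \<Longrightarrow> f x = L x"
  shows "Ck_on k S f"
proof (cases k)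
  case 0
  have "continuous_on S L"
    using assms(2) by (simp add: linear_continuous_on)
  then show ?thesis
    using 0 assms(3) by (simp cong: continuous_on_cong)
next
  case (Suc j)
  have "(f has_derivative L) (at x)" if "x \<in> S" for x
    using bounded_linear.has_derivative [OF assms(2) has_derivative_ident] assms(1) that
    by (rule has_derivative_transform_within_open) (simp add: assms(3))
  then show ?thesis
    unfolding Suc Ck_on.simps using Ck_on_const
    by (intro exI [of _ "\<lambda>_. L"]) auto
qed

lemma bounded_linear_mat_exp_curve:
  assumes "bounded_linear L"
  shows "((\<lambda>s. L (p ** mat_exp (s *\<^sub>R Z))) has_vector_derivative L (p ** (Z ** mat_exp (s *\<^sub>R Z))))
    (at s)"
  using bounded_linear.has_vector_derivative [OF bounded_linear_compose [OF assms
        bounded_bilinear.bounded_linear_right [OF bounded_bilinear_matrix_mult]]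
      mat_exp_has_vector_derivative] .

text \<open>The curve \<open>p ** mat_exp (s *\<^sub>R Z)\<close> starts at \<open>p\<close> and \<^const>\<open>GL\<close> is open, so for small \<open>s\<close> the
  function may be replaced by the linear one; every derivative in \<open>s\<close> then inserts one factor \<open>Z\<close>.\<close>

lemma lie_derivs_linear:
  fixes f L :: "real^'n^'n \<Rightarrow> complex"
  assumes L: "bounded_linear L" and f: "\<And>x. x \<in> GL \<Longrightarrow> f x = L x" and p: "p \<in> GL"
  shows lie_deriv_linear: "lie_deriv Z f p = L (p ** Z)"
    and lie_deriv2_linear: "lie_deriv2 Z f p = L (p ** (Z ** Z))"
proof -
  define S where "S = (\<lambda>s. p ** mat_exp (s *\<^sub>R Z)) -` GL"
  have "continuous_on UNIV (\<lambda>s. p ** mat_exp (s *\<^sub>R Z))"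
    by (intro bounded_bilinear.continuous_on [OF bounded_bilinear_matrix_mult] continuous_on_const
        continuous_at_imp_continuous_on ballI
        has_vector_derivative_continuous [OF mat_exp_has_vector_derivative])
  then have S: "open S"
    unfolding S_def using open_GL by (intro open_vimage)
  have 0: "0 \<in> S"
    using p by (simp add: S_def mat_exp_0)
  have deriv: "vector_derivative (\<lambda>t. f (p ** mat_exp (t *\<^sub>R Z))) (at s)
      = L (p ** (Z ** mat_exp (s *\<^sub>R Z)))" if "s \<in> S" for s
    using bounded_linear_mat_exp_curve [OF L] S that
    by (intro vector_derivative_at, rule has_vector_derivative_transform_within_open)
      (auto simp: S_def f)
  show "lie_deriv Z f p = L (p ** Z)"
    using deriv [OF 0] by (simp add: lie_deriv_def mat_exp_0)
  \<comment> \<open>The first derivative is again a linear function along such a curve, now starting at \<open>p ** Z\<close>.\<close>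
  have "((\<lambda>s. L ((p ** Z) ** mat_exp (s *\<^sub>R Z))) has_vector_derivative
      L ((p ** Z) ** (Z ** mat_exp (0 *\<^sub>R Z)))) (at 0)"
    by (rule bounded_linear_mat_exp_curve [OF L])
  then have "((\<lambda>s. vector_derivative (\<lambda>t. f (p ** mat_exp (t *\<^sub>R Z))) (at s)) has_vector_derivative
      L ((p ** Z) ** (Z ** mat_exp (0 *\<^sub>R Z)))) (at 0)"
    using S 0 by (rule has_vector_derivative_transform_within_open)
      (simp add: deriv matrix_mul_assoc)
  then show "lie_deriv2 Z f p = L (p ** (Z ** Z))"
    by (simp add: lie_deriv2_def vector_derivative_at mat_exp_0 matrix_mul_assoc)
qed

section \<open>Contraction over an orthonormal basis\<close>

text \<open>The metric is the Euclidean inner product, so \<open>Z $ i $ j\<close> is the coefficient of \<open>Z\<close> in the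
  expansion of the matrix unit \<open>E\<^sub>i\<^sub>j\<close> in the basis \<open>B\<close>; the left-hand side is therefore the
  \<open>(k,l)\<close> entry of \<open>E\<^sub>i\<^sub>j\<close>, whichever basis \<open>B\<close> is.\<close>

lemma orthonormal_basis_entries:
  fixes B :: "(real^'n^'n) set"
  assumes "gl_orthonormal_basis B"
  shows "(\<Sum>Z\<in>B. Z $ i $ j * Z $ k $ l) = (if i = k \<and> j = l then 1 else 0)"
proof -
  let ?E = "axis i (axis j 1) :: real^'n^'n"
  have "?E \<in> span B" and fin: "finite B"
    and ortho: "\<And>Z W. Z \<in> B \<Longrightarrow> W \<in> B \<Longrightarrow> Z \<bullet> W = (if Z = W then 1 else 0)"
    using assms by (auto simp: gl_orthonormal_basis_def gl_metric_eq_inner)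
  then have "(\<Sum>Z\<in>B. (?E \<bullet> Z) *\<^sub>R Z) = ?E"
    by (intro orthonormal_basis_expand) (auto simp: pairwise_def orthogonal_def norm_eq_sqrt_inner)
  then have "(\<Sum>Z\<in>B. Z $ i $ j *\<^sub>R Z) = ?E"
    by (simp add: inner_axis')
  from arg_cong [OF this, of "\<lambda>X. X $ k $ l"] show ?thesis
    by (auto simp: axis_def)
qed

lemma sum_squares_orthonormal_basis:
  fixes B :: "(real^'n^'n) set"
  assumes "gl_orthonormal_basis B"
  shows "(\<Sum>Z\<in>B. Z ** Z) = mat 1"
proof -
  have "(\<Sum>Z\<in>B. Z ** Z) $ i $ j = (mat 1 :: real^'n^'n) $ i $ j" for i j
  proof -
    have "(\<Sum>Z\<in>B. Z ** Z) $ i $ j = (\<Sum>k\<in>UNIV. \<Sum>Z\<in>B. Z $ i $ k * Z $ k $ j)"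
      by (simp add: matrix_matrix_mult_def sum.swap [of _ _ B])
    also have "\<dots> = (\<Sum>k\<in>UNIV. if k = i then (if k = j then 1 else 0) else 0)"
      unfolding orthonormal_basis_entries [OF assms] by (intro sum.cong) auto
    finally show ?thesis
      by (simp add: mat_def)
  qed
  then show ?thesis
    by (simp add: vec_eq_iff)
qed

text \<open>Parseval's identity for the form \<open>\<Sum> P\<^sub>i\<^sub>j Q\<^sub>i\<^sub>j\<close>. Since \<open>P\<close> and \<open>Q\<close> are complex and the form is
  bilinear rather than Hermitian, it may vanish even for \<open>P = Q \<noteq> 0\<close>; this is what isotropy exploits.\<close>

lemma sum_orthonormal_basis_product:
  fixes B :: "(real^'n^'n) set" and P Q :: "complex^'n^'n"
  assumes "gl_orthonormal_basis B"
  shows "(\<Sum>Z\<in>B. (\<Sum>i\<in>UNIV. \<Sum>j\<in>UNIV. P $ i $ j * complex_of_real (Z $ i $ j)) *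
        (\<Sum>k\<in>UNIV. \<Sum>l\<in>UNIV. Q $ k $ l * complex_of_real (Z $ k $ l)))
    = (\<Sum>i\<in>UNIV. \<Sum>j\<in>UNIV. P $ i $ j * Q $ i $ j)"
proof -
  \<comment> \<open>A pair of indices is treated as one index, so that each double sum becomes a single one.\<close>
  define z where "z Z x = complex_of_real (Z $ fst x $ snd x)" for Z :: "real^'n^'n" and x
  define p q where "p x = P $ fst x $ snd x" and "q x = Q $ fst x $ snd x" for x
  have pairs: "(\<Sum>i\<in>UNIV. \<Sum>j\<in>UNIV. f i j) = (\<Sum>x\<in>UNIV. f (fst x) (snd x))"
    for f :: "'n \<Rightarrow> 'n \<Rightarrow> complex"
    by (simp add: sum.cartesian_product case_prod_unfold)
  have entries: "(\<Sum>Z\<in>B. z Z x * z Z y) = (if x = y then 1 else 0)" for x y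
    using arg_cong [OF orthonormal_basis_entries [OF assms, of "fst x" "snd x" "fst y" "snd y"],
        of complex_of_real]
    by (simp add: z_def prod_eq_iff)
  have "(\<Sum>Z\<in>B. (\<Sum>x\<in>UNIV. p x * z Z x) * (\<Sum>y\<in>UNIV. q y * z Z y))
      = (\<Sum>Z\<in>B. \<Sum>x\<in>UNIV. \<Sum>y\<in>UNIV. p x * q y * (z Z x * z Z y))"
    by (simp add: sum_product mult_ac)
  also have "\<dots> = (\<Sum>x\<in>UNIV. \<Sum>y\<in>UNIV. \<Sum>Z\<in>B. p x * q y * (z Z x * z Z y))"
    by (subst sum.swap) (intro sum.cong refl sum.swap)
  also have "\<dots> = (\<Sum>x\<in>UNIV. \<Sum>y\<in>UNIV. p x * q y * (if x = y then 1 else 0))"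
    by (simp only: entries sum_distrib_left [symmetric])
  also have "\<dots> = (\<Sum>x\<in>UNIV. p x * q x)"
    by (simp add: if_distrib [of "\<lambda>c. _ * c"] cong: if_cong)
  finally show ?thesis
    by (simp add: pairs z_def p_def q_def)
qed

section \<open>The eigenvalue equations\<close>

text \<open>This is \<open>phi\<close> without the cut-off outside \<^const>\<open>GL\<close>, which would destroy linearity.\<close>

definition trace_form :: "complex^'n^'n \<Rightarrow> real^'n^'n \<Rightarrow> complex" where
  "trace_form A x = trace (A ** transpose (map_matrix complex_of_real x))"

lemma trace_form_entries:
  "trace_form A x = (\<Sum>i\<in>UNIV. \<Sum>j\<in>UNIV. A $ i $ j * complex_of_real (x $ i $ j))"
  by (simp add: trace_form_def trace_def matrix_matrix_mult_def transpose_def map_matrix_def)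

lemma phi_eq_trace_form: "x \<in> GL \<Longrightarrow> phi A x = trace_form A x"
  by (simp add: phi_def trace_form_def)

lemma bounded_linear_trace_form: "bounded_linear (trace_form A)"
  unfolding trace_form_entries [abs_def]
  by (intro bounded_linear_sum bounded_linear_const_mult
      bounded_linear_compose [OF bounded_linear_of_real]
      bounded_linear_compose [OF bounded_linear_vec_nth] bounded_linear_vec_nth)

text \<open>Moving \<open>p\<close> onto \<open>A\<close> exhibits \<open>Z \<mapsto> trace_form A (p ** Z)\<close> as an entrywise pairing with \<open>Z\<close>, the
  shape that the contraction over a basis needs. It acts on \<open>A\<close> from the left, that is, by
  combining rows.\<close>

lemma trace_form_matrix_mult:
  "trace_form A (p ** Z) = trace_form (transpose (map_matrix complex_of_real p) ** A) Z"
proof -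
  have "trace_form A (p ** Z) = (\<Sum>i\<in>UNIV. \<Sum>j\<in>UNIV. \<Sum>k\<in>UNIV.
      A $ i $ j * (complex_of_real (p $ i $ k) * complex_of_real (Z $ k $ j)))"
    by (simp add: trace_form_entries matrix_matrix_mult_def sum_distrib_left)
  also have "\<dots> = (\<Sum>k\<in>UNIV. \<Sum>j\<in>UNIV. \<Sum>i\<in>UNIV.
      A $ i $ j * (complex_of_real (p $ i $ k) * complex_of_real (Z $ k $ j)))"
    by (subst sum.swap, subst (2) sum.swap, subst sum.swap) simp
  also have "\<dots> = trace_form (transpose (map_matrix complex_of_real p) ** A) Z"
    by (simp add: trace_form_entries matrix_matrix_mult_def transpose_def map_matrix_def
        sum_distrib_left sum_distrib_right mult_ac)
  finally show ?thesis .
qed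

lemma tension_phi:
  assumes "gl_orthonormal_basis B" "p \<in> GL"
  shows "tension B (phi A) p = phi A p"
proof -
  have "tension B (phi A) p = (\<Sum>Z\<in>B. trace_form A (p ** (Z ** Z)))"
    by (simp add: tension_def lie_deriv2_linear [OF bounded_linear_trace_form phi_eq_trace_form]
        assms(2))
  also have "\<dots> = trace_form A (p ** (\<Sum>Z\<in>B. Z ** Z))"
    by (simp add: linear_sum [OF bounded_linear.linear [OF bounded_linear_trace_form]]
        bounded_bilinear.sum_right [OF bounded_bilinear_matrix_mult])
  also have "\<dots> = phi A p"
    by (simp add: sum_squares_orthonormal_basis [OF assms(1)] phi_eq_trace_form assms(2))
  finally show ?thesis .
qed

lemma row_matrix_mult_mem_subspace:
  assumes "vec.subspace V" "A \<in> row_matrices V"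
  shows "C ** A \<in> row_matrices V"
proof -
  have "row i (C ** A) = (\<Sum>k\<in>UNIV. C $ i $ k *s row k A)" for i
    by (simp add: row_def matrix_matrix_mult_def vec_eq_iff)
  then show ?thesis
    using assms by (auto simp: row_matrices_def intro!: vec.subspace_sum vec.subspace_scale)
qed

lemma kappa_phi:
  assumes "isotropic V" "A \<in> row_matrices V" "C \<in> row_matrices V"
    and "gl_orthonormal_basis B" "p \<in> GL"
  shows "kappa B (phi A) (phi C) p = 0"
proof -
  let ?q = "transpose (map_matrix complex_of_real p)"
  have "kappa B (phi A) (phi C) p = (\<Sum>Z\<in>B. trace_form A (p ** Z) * trace_form C (p ** Z))"
    by (simp add: kappa_def lie_deriv_linear [OF bounded_linear_trace_form phi_eq_trace_form]
        assms(5))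
  also have "\<dots> = (\<Sum>i\<in>UNIV. cbilin (row i (?q ** A)) (row i (?q ** C)))"
    unfolding trace_form_matrix_mult
    unfolding trace_form_entries sum_orthonormal_basis_product [OF assms(4)]
    by (simp add: cbilin_def row_def)
  also have "\<dots> = 0"
    using assms(1-3) row_matrix_mult_mem_subspace [of V _ ?q]
    by (auto simp: isotropic_def row_matrices_def intro!: sum.neutral)
  finally show ?thesis .
qed

lemma complex_function_space_family:
  fixes V :: "(complex^'n) set"
  assumes V: "vec.subspace V"
  shows "complex_function_space (family V)"
proof -
  have mod: "module (\<lambda>c (\<phi> :: real^'n^'n \<Rightarrow> complex) x. c * \<phi> x)"
    by unfold_locales (auto simp: algebra_simps)
  have add: "phi A + phi C = phi (A + C)"
    and scale: "(\<lambda>x. c * phi A x) = phi (\<chi> i. c *s A $ i)"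
    and zero: "phi 0 = 0" for A C :: "complex^'n^'n" and c
    by (auto simp: fun_eq_iff phi_def trace_def matrix_matrix_mult_def sum.distrib
        sum_distrib_left algebra_simps)
  have "0 \<in> row_matrices V"
    using vec.subspace_0 [OF V] by (simp add: row_matrices_def row_def)
  then have "(0 :: real^'n^'n \<Rightarrow> complex) \<in> family V"
    unfolding family_def using zero by (metis imageI)
  moreover have "\<phi> + \<psi> \<in> family V" if "\<phi> \<in> family V" "\<psi> \<in> family V" for \<phi> \<psi>
    using that vec.subspace_add [OF V]
    by (auto simp: family_def add row_matrices_def row_def plus_vec_def intro!: imageI)
  moreover have "(\<lambda>x. c * \<phi> x) \<in> family V" if "\<phi> \<in> family V" for c \<phi>
    using that vec.subspace_scale [OF V]
    by (auto simp: family_def scale row_matrices_def row_def intro!: imageI)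
  ultimately show ?thesis
    unfolding complex_function_space_def by (intro module.subspaceI [OF mod]) auto
qed

theorem theorem4p2:
  fixes V :: "(complex^'n) set"
  assumes "maximal_isotropic V"
  shows "complex_function_space (family V) \<and> eigenfamily (family V)"
proof
  have iso: "isotropic V"
    using assms by (simp add: maximal_isotropic_def)
  then show "complex_function_space (family V)"
    by (simp add: complex_function_space_family isotropic_def)
  have "tension B \<phi> p = 1 * \<phi> p"
    if "gl_orthonormal_basis B" "\<phi> \<in> family V" "p \<in> GL" for B \<phi> p
    using that tension_phi by (auto simp: family_def)
  moreover have "kappa B \<phi> \<psi> p = 0 * \<phi> p * \<psi> p"
    if "gl_orthonormal_basis B" "\<phi> \<in> family V" "\<psi> \<in> family V" "p \<in> GL" for B \<phi> \<psi> p
    using that kappa_phi [OF iso] by (auto simp: family_def)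
  moreover have "Ck_on k GL \<phi>" if "\<phi> \<in> family V" for k \<phi>
    using that Ck_on_eq_bounded_linear [OF open_GL bounded_linear_trace_form phi_eq_trace_form]
    by (auto simp: family_def)
  ultimately show "eigenfamily (family V)"
    unfolding eigenfamily_def by blast
qed

end
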